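(* For each integer $k \geq 0$ there is a constant $C_k > 0$, independent of $n$, such that $$|H_n(t)| \leq \frac{C_k}{t^k}$$ for all real $t > 0$ and all integers $n \geq 1$.
   Context: The functions $F_k$ ($k \in \{0,1,2,\ldots\}$, called Bateman functions) are defined for $t \geq 0$ as the Taylor coefficients, for $z$ in the open unit disk of $\mathbb{C}$, in the generating function $$e^{-t\,\frac{1+z}{1-z}} = \sum_{k=0}^{\infty} F_k(t)\, z^k .$$ For $n \geq 1$ the function $H_n$ is defined by $H_n(t) := (-1)^n F_n(nt)$. *)

theory Defs
  imports "HOL-Complex_Analysis.Complex_Analysis"
begin

definition bateman_gen :: "real \<Rightarrow> complex \<Rightarrow> complex" where
  "bateman_gen t z = exp (- of_real t * ((1 + z) / (1 - z)))"

(* The values are real (see bateman_F_real), but the codomain is complex because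
   the generating function is expanded on the complex unit disk. The definition
   makes sense for every real t; only t \<ge> 0 is of interest. *)
definition bateman_F :: "nat \<Rightarrow> real \<Rightarrow> complex" where
  "bateman_F k t = (deriv ^^ k) (bateman_gen t) 0 / fact k"

definition bateman_H :: "nat \<Rightarrow> real \<Rightarrow> complex" where
  "bateman_H n t = (- 1) ^ n * bateman_F n (of_nat n * t)"

lemma bateman_gen_holomorphic: "bateman_gen t holomorphic_on ball 0 1"
  unfolding bateman_gen_def by (intro holomorphic_intros) auto

lemma bateman_F_sums:
  assumes "norm z < 1"
  shows "(\<lambda>k. bateman_F k t * z ^ k) sums bateman_gen t z"
  using holomorphic_power_series[OF bateman_gen_holomorphic, of z t] assms
  by (simp add: bateman_F_def)

lemma bateman_F_real: "bateman_F k t \<in> \<real>"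
proof -
  have *: "cnj (bateman_gen t (cnj z)) = bateman_gen t z" for z
    by (simp add: bateman_gen_def exp_cnj)
  have sums: "(\<lambda>k. cnj (bateman_F k t) * z ^ k) sums bateman_gen t z" if "norm z < 1" for z
    using sums_cnj[THEN iffD2, OF bateman_F_sums[of "cnj z" t]] that by (simp add: *)
  have "(\<lambda>k. cnj (bateman_F k t)) = (\<lambda>k. bateman_F k t)"
  proof (rule ext)
    fix k
    have "fps_expansion (bateman_gen t) 0 = Abs_fps (\<lambda>k. cnj (bateman_F k t))"
    proof (rule fps_expansion_eqI, rule has_fps_expansionI)
      show "\<forall>\<^sub>F z in nhds 0. (\<lambda>n. fps_nth (Abs_fps (\<lambda>k. cnj (bateman_F k t))) n * z ^ n)
              sums bateman_gen t z"
        using eventually_nhds_in_open[of "ball 0 1" "0::complex"]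
        by (auto elim!: eventually_mono simp: sums)
    qed
    then have "fps_nth (fps_expansion (bateman_gen t) 0) k = cnj (bateman_F k t)"
      by simp
    then show "cnj (bateman_F k t) = bateman_F k t"
      by (simp add: fps_expansion_def bateman_F_def)
  qed
  then show ?thesis
    by (metis Reals_cnj_iff)
qed

end

theory Submission
  imports Defs
begin

text \<open>
  The generating function \<open>G\<close> is bounded by \<open>1\<close> on the unit disk when \<open>t \<ge> 0\<close>, so Cauchy's
  inequality gives \<open>|F\<^sub>n(t)| \<le> 1\<close>. Moreover \<open>(1 - z)\<^sup>2 G' = - 2 t G\<close>, which expresses
  \<open>2 t F\<^sub>n(t)\<close> through \<open>(n + 1) F\<^sub>n\<^sub>+\<^sub>1(t)\<close>, \<open>2 n F\<^sub>n(t)\<close> and \<open>(n - 1) F\<^sub>n\<^sub>-\<^sub>1(t)\<close>. So every factor \<open>t\<close>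
  costs at most a constant times \<open>n\<close>, and \<open>t\<^sup>k |F\<^sub>n(t)| \<le> C\<^sub>k n\<^sup>k\<close> follows by induction on \<open>k\<close>.
\<close>

text \<open>The numerator of the real part is 1 - |z|^2. At z = 1 division by zero gives 0, so this
  boundary point needs no exception.\<close>

lemma Re_cayley_nonneg:
  fixes z :: complex
  assumes "norm z \<le> 1"
  shows "0 \<le> Re ((1 + z) / (1 - z))"
proof -
  have "(Re z)\<^sup>2 + (Im z)\<^sup>2 \<le> 1"
    using assms by (simp add: cmod_def)
  then have "0 \<le> (1 + Re z) * (1 - Re z) - Im z * Im z"
    by (simp add: algebra_simps power2_eq_square)
  then show ?thesis
    by (simp add: Re_divide)
qed

lemma norm_bateman_gen_le_1:
  assumes "t \<ge> 0" "norm z \<le> 1"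
  shows "norm (bateman_gen t z) \<le> 1"
proof -
  have "0 \<le> t * Re ((1 + z) / (1 - z))"
    using assms by (intro mult_nonneg_nonneg Re_cayley_nonneg)
  then show ?thesis
    by (simp add: bateman_gen_def del: times_divide_eq_right)
qed

lemma norm_bateman_F_le_1:
  assumes "t \<ge> 0"
  shows "norm (bateman_F n t) \<le> 1"
proof -
  \<comment> \<open>For t > 0 the generating function is not continuous at z = 1, so Cauchy's
    inequality is applied on circles of radius r < 1; letting r tend to 1 from below then removes
    the factor 1 / r^n.\<close>
  have bound: "norm (bateman_F n t) \<le> 1 / r ^ n" if r: "0 < r" "r < 1" for r
  proof -
    have hol: "bateman_gen t holomorphic_on cball 0 r"
      using bateman_gen_holomorphic by (rule holomorphic_on_subset) (use r in auto)
    have "norm ((deriv ^^ n) (bateman_gen t) 0) \<le> fact n * 1 / r ^ n"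
    proof (rule Cauchy_inequality)
      show "bateman_gen t holomorphic_on ball 0 r"
        using hol by (rule holomorphic_on_subset) auto
      show "continuous_on (cball 0 r) (bateman_gen t)"
        using hol by (rule holomorphic_on_imp_continuous_on)
    qed (use assms r in \<open>auto intro: norm_bateman_gen_le_1\<close>)
    then show ?thesis
      by (simp add: bateman_F_def norm_divide field_simps)
  qed
  have lim: "((\<lambda>r::real. 1 / r ^ n) \<longlongrightarrow> 1 / 1 ^ n) (at_left 1)"
    by (intro tendsto_intros) auto
  have "\<forall>\<^sub>F r::real in at_left 1. norm (bateman_F n t) \<le> 1 / r ^ n"
    using eventually_at_left_real[of 0 1] by (auto elim!: eventually_mono intro: bound)
  then show ?thesis
    using tendsto_lowerbound[OF lim] by simp
qed

lemma bateman_gen_has_fps_expansion: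
  "bateman_gen t has_fps_expansion Abs_fps (\<lambda>k. bateman_F k t)"
proof (rule has_fps_expansionI)
  show "\<forall>\<^sub>F z in nhds 0. (\<lambda>n. fps_nth (Abs_fps (\<lambda>k. bateman_F k t)) n * z ^ n)
          sums bateman_gen t z"
    using eventually_nhds_in_open[of "ball 0 1" "0::complex"]
    by (auto elim!: eventually_mono simp: bateman_F_sums)
qed

lemma bateman_gen_ode:
  assumes "norm z < 1"
  shows "(1 - z)\<^sup>2 * deriv (bateman_gen t) z = - (2 * of_real t) * bateman_gen t z"
proof -
  have z: "1 - z \<noteq> 0"
    using assms by auto
  have "(bateman_gen t has_field_derivative
          bateman_gen t z * (- of_real t * (2 / (1 - z)\<^sup>2))) (at z)"
    unfolding bateman_gen_def
    by (rule derivative_eq_intros refl z)+ (use z in \<open>simp add: field_simps power2_eq_square\<close>)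
  then have "deriv (bateman_gen t) z = bateman_gen t z * (- of_real t * (2 / (1 - z)\<^sup>2))"
    by (rule DERIV_imp_deriv)
  then show ?thesis
    using z by simp
qed

text \<open>This compares the coefficients of z^(m+1) in the differential equation
  \<open>bateman_gen_ode\<close>. Indexing by \<open>Suc m\<close> avoids subtraction on
  naturals.\<close>

lemma bateman_F_recurrence:
  "2 * of_real t * bateman_F (Suc m) t =
     2 * of_nat (Suc m) * bateman_F (Suc m) t
     - of_nat (m + 2) * bateman_F (m + 2) t - of_nat m * bateman_F m t"
proof -
  define G where "G = Abs_fps (\<lambda>k. bateman_F k t)"
  have G: "bateman_gen t has_fps_expansion G"
    unfolding G_def by (rule bateman_gen_has_fps_expansion)
  have "(\<lambda>z. (1 - z)\<^sup>2 * deriv (bateman_gen t) z) has_fps_expansion (1 - fps_X)\<^sup>2 * fps_deriv G"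
    unfolding power2_eq_square by (intro fps_expansion_intros G)
  moreover have "\<forall>\<^sub>F z in nhds 0. (1 - z)\<^sup>2 * deriv (bateman_gen t) z
                   = - (2 * of_real t) * bateman_gen t z"
    using eventually_nhds_in_open[of "ball 0 1" "0::complex"]
    by (auto elim!: eventually_mono simp: bateman_gen_ode)
  ultimately have "(\<lambda>z. - (2 * of_real t) * bateman_gen t z)
                     has_fps_expansion (1 - fps_X)\<^sup>2 * fps_deriv G"
    by (simp cong: has_fps_expansion_cong)
  moreover have "(\<lambda>z. - (2 * of_real t) * bateman_gen t z)
                   has_fps_expansion fps_const (- (2 * of_real t)) * G"
    by (intro fps_expansion_intros G)
  ultimately have "(1 - fps_X)\<^sup>2 * fps_deriv G = fps_const (- (2 * of_real t)) * G"
    using fps_expansion_unique_complex by blast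
  \<comment> \<open>Nested products with \<open>fps_X\<close> turn coefficient extraction into plain
    index shifts.\<close>
  then have "fps_deriv G - 2 * (fps_X * fps_deriv G) + fps_X * (fps_X * fps_deriv G)
               = fps_const (- (2 * of_real t)) * G"
    by (simp add: power2_eq_square algebra_simps)
  then have "fps_nth (fps_deriv G - 2 * (fps_X * fps_deriv G) + fps_X * (fps_X * fps_deriv G))
               (Suc m) = fps_nth (fps_const (- (2 * of_real t)) * G) (Suc m)"
    by simp
  then have "of_nat (m + 2) * bateman_F (m + 2) t - 2 * (of_nat (Suc m) * bateman_F (Suc m) t)
               + of_nat m * bateman_F m t = - (2 * of_real t) * bateman_F (Suc m) t"
    \<comment> \<open>For m = 0 the doubly shifted series has no coefficient at index 1, which
      agrees with the factor m in front of \<open>bateman_F m t\<close>.\<close>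
    by (cases m) (simp_all add: G_def fps_mult_numeral_left del: of_nat_Suc)
  then show ?thesis
    by (simp add: algebra_simps)
qed

lemma bateman_F_decay:
  "\<exists>C>0. \<forall>n t. n \<ge> 1 \<longrightarrow> t \<ge> 0 \<longrightarrow> t ^ k * norm (bateman_F n t) \<le> C * real n ^ k"
proof (induction k)
  case 0
  then show ?case
    by (intro exI[of _ 1]) (auto simp: norm_bateman_F_le_1)
next
  case (Suc k)
  then obtain C where C: "C > 0"
    "\<And>n t. n \<ge> 1 \<Longrightarrow> t \<ge> 0 \<Longrightarrow> t ^ k * norm (bateman_F n t) \<le> C * real n ^ k"
    by blast
  \<comment> \<open>The constant is 4 * 2^(k+1) * C, halved because the recurrence bounds 2 t
    |F_n(t)|.\<close>
  have "t ^ Suc k * norm (bateman_F n t) \<le> 2 * 2 ^ Suc k * C * real n ^ Suc k"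
    if n: "n \<ge> 1" and t: "t \<ge> 0" for n t
  proof -
    obtain m where m: "n = Suc m"
      using n by (cases n) auto
    \<comment> \<open>One common bound for the three neighbours m, m + 1, m + 2. The induction
      hypothesis says nothing about j = 0, but there the factor j makes the left side
      vanish.\<close>
    have step: "t ^ k * (real j * norm (bateman_F j t)) \<le> C * real (m + 2) ^ Suc k"
      if "j \<le> m + 2" for j
    proof (cases "j = 0")
      case False
      have "t ^ k * (real j * norm (bateman_F j t)) = real j * (t ^ k * norm (bateman_F j t))"
        by simp
      also have "\<dots> \<le> real j * (C * real j ^ k)"
        using C(2)[of j t] False t by (intro mult_left_mono) auto
      also have "\<dots> = C * real j ^ Suc k"
        by simp
      also have "\<dots> \<le> C * real (m + 2) ^ Suc k"
        using that C(1) by (intro mult_left_mono power_mono) auto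
      finally show ?thesis .
    qed (use C(1) in auto)
    have "2 * t * norm (bateman_F n t) = norm (2 * of_real t * bateman_F (Suc m) t)"
      using t by (simp add: norm_mult m)
    also have "\<dots> \<le> norm (2 * of_nat (Suc m) * bateman_F (Suc m) t)
        + norm (of_nat (m + 2) * bateman_F (m + 2) t) + norm (of_nat m * bateman_F m t)"
      unfolding bateman_F_recurrence
      by (meson add_right_mono norm_triangle_ineq4 order_trans)
    also have "\<dots> = 2 * (real (Suc m) * norm (bateman_F (Suc m) t))
        + real (m + 2) * norm (bateman_F (m + 2) t) + real m * norm (bateman_F m t)"
      by (simp add: norm_mult del: of_nat_Suc of_nat_add)
    finally have "t ^ k * (2 * t * norm (bateman_F n t)) \<le> t ^ k * \<dots>"
      using t by (intro mult_left_mono) auto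
    also have "\<dots> = 2 * (t ^ k * (real (Suc m) * norm (bateman_F (Suc m) t)))
        + t ^ k * (real (m + 2) * norm (bateman_F (m + 2) t))
        + t ^ k * (real m * norm (bateman_F m t))"
      by (simp add: distrib_left del: of_nat_Suc of_nat_add)
    \<comment> \<open>The three terms carry the weights 2, 1 and 1.\<close>
    also have "\<dots> \<le> 4 * (C * real (m + 2) ^ Suc k)"
      using step[of "Suc m"] step[of "m + 2"] step[of m] by linarith
    \<comment> \<open>m + 2 = n + 1 is at most 2 n because n is at least 1.\<close>
    also have "\<dots> \<le> 4 * (C * (2 * real n) ^ Suc k)"
      using C(1) m by (intro mult_left_mono power_mono) auto
    finally show ?thesis
      by (simp add: power_mult_distrib mult_ac)
  qed
  then show ?case
    using C(1) by (intro exI[of _ "2 * 2 ^ Suc k * C"]) auto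
qed

theorem theorem6:
  fixes k :: nat
  shows "\<exists>C::real. C > 0 \<and> (\<forall>(n::nat) (t::real). n \<ge> 1 \<longrightarrow> t > 0 \<longrightarrow> norm (bateman_H n t) \<le> C / t ^ k)"
proof -
  obtain C where C: "C > 0"
    "\<And>n t. n \<ge> 1 \<Longrightarrow> t \<ge> 0 \<Longrightarrow> t ^ k * norm (bateman_F n t) \<le> C * real n ^ k"
    using bateman_F_decay by blast
  have "norm (bateman_H n t) \<le> C / t ^ k" if "n \<ge> 1" "t > 0" for n t
  proof -
    \<comment> \<open>At the argument n t the power t^k of the decay bound becomes n^k t^k, so n^k
      cancels and the constant no longer depends on n.\<close>
    have "real n ^ k * (t ^ k * norm (bateman_F n (real n * t))) \<le> real n ^ k * C"
      using C(2)[of n "real n * t"] that by (simp add: power_mult_distrib mult_ac)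
    then have "t ^ k * norm (bateman_F n (real n * t)) \<le> C"
      using that by (subst (asm) mult_le_cancel_left_pos) auto
    then show ?thesis
      using that by (simp add: bateman_H_def norm_mult norm_power field_simps)
  qed
  with C(1) show ?thesis
    by blast
qed

end
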